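(* For every $\varepsilon>0$, there is $\delta>0$ such that the following holds. If $G$ is an $n$-vertex graph with $\lambda(G)\ge\left(\frac12-\delta\right)n$, then either $$\operatorname{bk}(G)\ge\left(\frac16-\varepsilon\right)n,$$ or $G$ can be changed into $T_{n,2}$ by adding and deleting at most $\varepsilon n^2$ edges.
   Context: Graphs are finite and simple. $\lambda(G)$ is the spectral radius of the adjacency matrix of $G$. The booksize is $\operatorname{bk}(G)=\max_{uv\in E(G)}|N(u)\cap N(v)|$, the maximum number of triangles sharing a common edge. $T_{n,2}$ is the balanced complete bipartite graph on $n$ vertices, with parts of sizes $\lfloor n/2\rfloor$ and $\lceil n/2\rceil$. "Changed into $T_{n,2}$" means: there is a copy $K$ of $T_{n,2}$ on the vertex set $V(G)$ such that the symmetric difference of $E(G)$ and $E(K)$ has at most $\varepsilon n^2$ elements. *)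

theory Defs
  imports Complex_Main "Jordan_Normal_Form.Spectral_Radius"
begin

text \<open>A finite simple graph is a pair \<open>(V, E)\<close> of a finite vertex set and a set of two-element
  subsets of \<open>V\<close>.\<close>

definition simple_graph :: "'a set \<Rightarrow> 'a set set \<Rightarrow> bool" where
  "simple_graph V E \<longleftrightarrow> finite V \<and> E \<subseteq> {e. e \<subseteq> V \<and> card e = 2}"

definition nbhd :: "'a set set \<Rightarrow> 'a \<Rightarrow> 'a set" where
  "nbhd E u = {w. {u, w} \<in> E}"

text \<open>The rows and columns are indexed by the positions of a list enumerating the vertices; the
  entries are complex because the library's spectral radius is defined for complex matrices.\<close>

definition adj_mat :: "'a list \<Rightarrow> 'a set set \<Rightarrow> complex mat" where
  "adj_mat vs E =
     mat (length vs) (length vs) (\<lambda>(i, j). if {vs ! i, vs ! j} \<in> E then 1 else 0)"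

text \<open>The choice of the enumeration is immaterial, see \<open>graph_spectral_radius_eq\<close> below. For
  \<open>V = {}\<close> the value is unspecified, the spectrum being empty.\<close>

definition graph_spectral_radius :: "'a set \<Rightarrow> 'a set set \<Rightarrow> real" where
  "graph_spectral_radius V E =
     spectral_radius (adj_mat (SOME vs. distinct vs \<and> set vs = V) E)"

text \<open>The element \<open>0\<close> is inserted only to make the booksize of an edgeless graph \<open>0\<close>.\<close>

definition booksize :: "'a set set \<Rightarrow> nat" where
  "booksize E = Max (insert 0 {card (nbhd E u \<inter> nbhd E v) | u v. {u, v} \<in> E})"

text \<open>\<open>K\<close> is the edge set of a copy of the balanced complete bipartite graph \<open>T\<^sub>n\<^sub>,\<^sub>2\<close> with vertex
  set \<open>V\<close>, where \<open>n = card V\<close>.\<close>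

definition is_turan2_on :: "'a set \<Rightarrow> 'a set set \<Rightarrow> bool" where
  "is_turan2_on V K \<longleftrightarrow>
     (\<exists>A B. A \<union> B = V \<and> A \<inter> B = {} \<and>
        int (card A) = \<lfloor>real (card V) / 2\<rfloor> \<and> int (card B) = \<lceil>real (card V) / 2\<rceil> \<and>
        K = {{a, b} | a b. a \<in> A \<and> b \<in> B})"

lemma eigenvalue_adj_mat_iff:
  assumes "distinct vs"
  shows "eigenvalue (adj_mat vs E) k \<longleftrightarrow>
    (\<exists>f. (\<exists>x\<in>set vs. f x \<noteq> 0) \<and>
         (\<forall>x\<in>set vs. (\<Sum>y\<in>set vs. if {x, y} \<in> E then f y else 0) = k * f x))"
    (is "?L \<longleftrightarrow> ?R")
proof -
  let ?n = "length vs"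
  have sum_nth: "(\<Sum>y\<in>set vs. g y) = (\<Sum>j<?n. g (vs ! j))" for g :: "'a \<Rightarrow> complex"
    by (rule sum.reindex_bij_betw[OF bij_betw_nth[OF assms refl refl], symmetric])
  have mult: "(adj_mat vs E *\<^sub>v v) $ i = (\<Sum>j<?n. if {vs ! i, vs ! j} \<in> E then v $ j else 0)"
    if "i < ?n" "v \<in> carrier_vec ?n" for i v
    using that by (auto simp: adj_mat_def scalar_prod_def lessThan_atLeast0 intro!: sum.cong)
  have dim: "dim_row (adj_mat vs E) = ?n" "dim_col (adj_mat vs E) = ?n"
    by (simp_all add: adj_mat_def)
  show ?thesis
  proof
    assume ?L
    then obtain v where v: "v \<in> carrier_vec ?n" "v \<noteq> 0\<^sub>v ?n" "adj_mat vs E *\<^sub>v v = k \<cdot>\<^sub>v v"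
      unfolding eigenvalue_def eigenvector_def dim by blast
    define f where "f x = v $ (THE i. i < ?n \<and> vs ! i = x)" for x
    have f: "f (vs ! i) = v $ i" if "i < ?n" for i
    proof -
      have "(THE j. j < ?n \<and> vs ! j = vs ! i) = i"
        by (rule the_equality) (use that assms nth_eq_iff_index_eq in blast)+
      then show ?thesis by (simp add: f_def)
    qed
    obtain i where i: "i < ?n" "v $ i \<noteq> 0"
      using v(1,2) by (metis carrier_vecD eq_vecI index_zero_vec(1) index_zero_vec(2))
    have "(\<Sum>y\<in>set vs. if {x, y} \<in> E then f y else 0) = k * f x" if x: "x \<in> set vs" for x
    proof -
      obtain j where j: "j < ?n" "x = vs ! j" using x by (metis in_set_conv_nth)
      have "(\<Sum>y\<in>set vs. if {x, y} \<in> E then f y else 0) = (adj_mat vs E *\<^sub>v v) $ j"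
        unfolding sum_nth mult[OF j(1) v(1)] j(2) by (intro sum.cong refl) (simp add: f)
      also have "\<dots> = k * f x" using v(1,3) j f by simp
      finally show ?thesis .
    qed
    moreover have "\<exists>x\<in>set vs. f x \<noteq> 0" using i f by (metis nth_mem)
    ultimately show ?R by blast
  next
    assume ?R
    then obtain f where f: "\<exists>x\<in>set vs. f x \<noteq> 0"
      "\<forall>x\<in>set vs. (\<Sum>y\<in>set vs. if {x, y} \<in> E then f y else 0) = k * f x" by blast
    define v where "v = vec ?n (\<lambda>i. f (vs ! i))"
    have v: "v \<in> carrier_vec ?n" by (simp add: v_def)
    obtain i where "i < ?n" "f (vs ! i) \<noteq> 0" using f(1) by (metis in_set_conv_nth)
    then have "v \<noteq> 0\<^sub>v ?n" by (metis v_def index_vec index_zero_vec(1))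
    moreover have "adj_mat vs E *\<^sub>v v = k \<cdot>\<^sub>v v"
    proof (rule eq_vecI)
      fix i assume "i < dim_vec (k \<cdot>\<^sub>v v)"
      then have i: "i < ?n" by (simp add: v_def)
      have "(adj_mat vs E *\<^sub>v v) $ i = (\<Sum>y\<in>set vs. if {vs ! i, y} \<in> E then f y else 0)"
        unfolding sum_nth mult[OF i v] by (intro sum.cong refl) (simp add: v_def)
      then show "(adj_mat vs E *\<^sub>v v) $ i = (k \<cdot>\<^sub>v v) $ i"
        using f(2) i by (simp add: v_def)
    qed (simp add: dim v_def)
    ultimately show ?L unfolding eigenvalue_def eigenvector_def dim using v by blast
  qed
qed

lemma graph_spectral_radius_eq:
  assumes "distinct vs" "set vs = V"
  shows "graph_spectral_radius V E = spectral_radius (adj_mat vs E)"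
proof -
  define ws where "ws = (SOME vs. distinct vs \<and> set vs = V)"
  have ws: "distinct ws \<and> set ws = V"
    unfolding ws_def by (rule someI[of _ vs]) (use assms in blast)
  have "spectrum (adj_mat ws E) = spectrum (adj_mat vs E)"
    using ws assms by (auto simp: spectrum_def eigenvalue_adj_mat_iff)
  then show ?thesis by (simp add: graph_spectral_radius_def spectral_radius_def ws_def)
qed

end

(* Fix a vertex v. Every triangle has an edge with both or neither end in N(v), so the number t of
   triangles is at most b (the booksize) times the number of edges inside N(v) or inside its
   complement. Averaging over v gives t (n - 6 b) <= b (n m - 4 m^2 / n), so few triangles if
   m >= (1/4 - o(1)) n^2. Averaging instead with weights f, where f >= 0 and A f >= lambda f, gives
   S t <= b (S (m - lambda^2) + 2 (sum of the f-weights of all triangles)), S = sum f. A triangle of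
   maximal f-weight shows that all triangles have f-weight at most S / (lambda - b), whence
   t (lambda - 3 b) <= b (m - lambda^2) (lambda - b). So either m > lambda^2, and the first bound
   applies, or there are no triangles at all, which forces f to be nearly constant and again
   m >= (1/4 - o(1)) n^2. With m large and t small, the average over v provides a vertex for which
   few edges lie inside N(v) or inside its complement. *)

theory Submission
  imports Defs "HOL-Analysis.Convex"
begin

section \<open>Adjacency kernels, triangles and neighbourhood cuts\<close>

locale book_graph =
  fixes V :: "'a set" and a :: "'a \<Rightarrow> 'a \<Rightarrow> real" and b :: real
  assumes fin: "finite V"
    and a01: "a u v = 0 \<or> a u v = 1"
    and sym: "a u v = a v u"
    and book: "u \<in> V \<Longrightarrow> v \<in> V \<Longrightarrow> a u v = 1 \<Longrightarrow> (\<Sum>x\<in>V. a u x * a v x) \<le> b"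
begin

definition nb :: "('a \<Rightarrow> real) \<Rightarrow> 'a \<Rightarrow> real" where
  "nb \<phi> u = (\<Sum>v\<in>V. a u v * \<phi> v)"

definition deg :: "'a \<Rightarrow> real" where
  "deg u = (\<Sum>v\<in>V. a u v)"

text \<open>In a graph this is twice the number of edges.\<close>

definition vol :: real where
  "vol = (\<Sum>u\<in>V. deg u)"

definition tri :: "'a \<Rightarrow> 'a \<Rightarrow> 'a \<Rightarrow> real" where
  "tri u w x = a u w * a w x * a u x"

text \<open>Triangles are counted as ordered triples, so \<open>tris (\<lambda>_. 1)\<close> is six
  times the number of triangles; \<open>\<phi>\<close> is charged at the last vertex of the
  triple.\<close>

definition tris :: "('a \<Rightarrow> real) \<Rightarrow> real" where
  "tris \<phi> = (\<Sum>u\<in>V. \<Sum>w\<in>V. \<Sum>x\<in>V. tri u w x * \<phi> x)"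

text \<open>For 0/1 values this polynomial is the indicator that \<open>u\<close> and
  \<open>w\<close> lie on the same side of the cut formed by the neighbourhood of \<open>v\<close>
  and its complement.\<close>

definition mono_ind :: "'a \<Rightarrow> 'a \<Rightarrow> 'a \<Rightarrow> real" where
  "mono_ind v u w = 1 - a v u - a v w + 2 * a v u * a v w"

definition mono_wt :: "('a \<Rightarrow> real) \<Rightarrow> 'a \<Rightarrow> 'a \<Rightarrow> real" where
  "mono_wt \<phi> u w = (\<Sum>v\<in>V. \<phi> v * mono_ind v u w)"

lemma a_ge0 [simp]: "0 \<le> a u v" and a_le1 [simp]: "a u v \<le> 1"
  using a01[of u v] by auto

lemma tri_ge0 [simp]: "0 \<le> tri u w x"
  by (simp add: tri_def)

lemma mono_ind_ge0: "0 \<le> mono_ind v u w"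
  using a01[of v u] a01[of v w] by (auto simp: mono_ind_def)

text \<open>Pigeonhole: the cut has two sides, so two of any three vertices share one.\<close>

lemma mono_ind_tri: "1 \<le> mono_ind v u w + mono_ind v w x + mono_ind v u x"
  using a01[of v u] a01[of v w] a01[of v x] by (auto simp: mono_ind_def)

lemma mono_wt_ge0: "(\<And>v. v \<in> V \<Longrightarrow> 0 \<le> \<phi> v) \<Longrightarrow> 0 \<le> mono_wt \<phi> u w"
  unfolding mono_wt_def by (intro sum_nonneg mult_nonneg_nonneg mono_ind_ge0)

lemma mono_wt_eq:
  "mono_wt \<phi> u w = sum \<phi> V - nb \<phi> u - nb \<phi> w + 2 * (\<Sum>v\<in>V. a u v * a w v * \<phi> v)"
  unfolding mono_wt_def mono_ind_def nb_def sum_distrib_left sum_subtractf[symmetric] sum.distrib[symmetric]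
  by (intro sum.cong refl) (simp add: algebra_simps sym)

section \<open>Double counting of triangles over neighbourhood cuts\<close>

lemma sum_a_nb: "(\<Sum>u\<in>V. \<Sum>w\<in>V. a u w * nb \<phi> u) = (\<Sum>u\<in>V. deg u * nb \<phi> u)"
  by (simp add: deg_def sum_distrib_right)

lemma sum_a_nb': "(\<Sum>u\<in>V. \<Sum>w\<in>V. a u w * nb \<phi> w) = (\<Sum>u\<in>V. deg u * nb \<phi> u)"
  by (subst sum.swap) (simp add: deg_def sum_distrib_right sym)

text \<open>Expanding \<open>mono_wt\<close> over adjacent pairs, the two \<open>nb\<close> terms
  contribute equally by symmetry, and the weighted codegree of an edge sums to
  \<open>tris \<phi>\<close>.\<close>

lemma sum_a_mono_wt:
  "(\<Sum>u\<in>V. \<Sum>w\<in>V. a u w * mono_wt \<phi> u w)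
     = sum \<phi> V * vol - 2 * (\<Sum>u\<in>V. deg u * nb \<phi> u) + 2 * tris \<phi>"
proof -
  have "(\<Sum>u\<in>V. \<Sum>w\<in>V. a u w * mono_wt \<phi> u w)
     = (\<Sum>u\<in>V. \<Sum>w\<in>V. (sum \<phi> V * a u w - a u w * nb \<phi> u - a u w * nb \<phi> w)
         + 2 * (\<Sum>x\<in>V. tri u w x * \<phi> x))"
    unfolding mono_wt_eq tri_def
    by (intro sum.cong refl) (simp add: algebra_simps sum_distrib_left)
  also have "\<dots> = sum \<phi> V * vol - 2 * (\<Sum>u\<in>V. deg u * nb \<phi> u) + 2 * tris \<phi>"
    by (simp add: sum.distrib sum_subtractf sum_a_nb sum_a_nb' tris_def vol_def deg_def
        flip: sum_distrib_left)
  finally show ?thesis .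
qed

lemma sum3_rot:
  "(\<Sum>u\<in>V. \<Sum>w\<in>V. \<Sum>x\<in>V. F u w x) = (\<Sum>u\<in>V. \<Sum>w\<in>V. \<Sum>x\<in>V. (F x u w :: real))"
proof -
  have "(\<Sum>u\<in>V. \<Sum>w\<in>V. \<Sum>x\<in>V. F x u w) = (\<Sum>u\<in>V. \<Sum>x\<in>V. \<Sum>w\<in>V. F x u w)"
    by (rule sum.cong[OF refl], rule sum.swap)
  also have "\<dots> = (\<Sum>x\<in>V. \<Sum>u\<in>V. \<Sum>w\<in>V. F x u w)"
    by (rule sum.swap)
  finally show ?thesis by simp
qed

lemma tri_rot: "tri x u w = tri u w x"
  by (simp add: tri_def sym mult_ac)

lemma tris_ge0: "0 \<le> tris (\<lambda>_. 1)"
  by (simp add: tris_def sum_nonneg)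

text \<open>Every cut leaves some edge of a triangle within one side, so the three edges of a
  triangle carry total \<open>mono_wt\<close> at least \<open>sum \<phi> V\<close>. By rotation the
  three edges contribute the same overall, whence the factor 3, and an edge extends to a triangle in
  at most \<open>b\<close> ways.\<close>

lemma tris_le:
  assumes nn: "\<And>v. v \<in> V \<Longrightarrow> 0 \<le> \<phi> v"
  shows "sum \<phi> V * tris (\<lambda>_. 1)
     \<le> 3 * b * (sum \<phi> V * vol - 2 * (\<Sum>u\<in>V. deg u * nb \<phi> u) + 2 * tris \<phi>)"
proof -
  let ?M = "mono_wt \<phi>"
  have M: "sum \<phi> V \<le> ?M u w + ?M w x + ?M u x" for u w x
    unfolding mono_wt_def sum.distrib[symmetric] distrib_left[symmetric]
    by (rule sum_mono) (metis mono_ind_tri mult.right_neutral mult_left_mono nn)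
  have symM: "?M u w = ?M w u" for u w
    by (simp add: mono_wt_def mono_ind_def algebra_simps)
  have "sum \<phi> V * tris (\<lambda>_. 1) = (\<Sum>u\<in>V. \<Sum>w\<in>V. \<Sum>x\<in>V. tri u w x * sum \<phi> V)"
    by (simp add: tris_def sum_distrib_left mult.commute)
  also have "\<dots> \<le> (\<Sum>u\<in>V. \<Sum>w\<in>V. \<Sum>x\<in>V. tri u w x * (?M u w + ?M w x + ?M u x))"
    by (intro sum_mono mult_left_mono M) simp
  also have "\<dots> = (\<Sum>u\<in>V. \<Sum>w\<in>V. \<Sum>x\<in>V. tri u w x * ?M u w)
      + (\<Sum>u\<in>V. \<Sum>w\<in>V. \<Sum>x\<in>V. tri u w x * ?M w x)
      + (\<Sum>u\<in>V. \<Sum>w\<in>V. \<Sum>x\<in>V. tri u w x * ?M u x)"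
    by (simp add: distrib_left sum.distrib)
  also have "(\<Sum>u\<in>V. \<Sum>w\<in>V. \<Sum>x\<in>V. tri u w x * ?M w x)
      = (\<Sum>u\<in>V. \<Sum>w\<in>V. \<Sum>x\<in>V. tri u w x * ?M u w)"
    by (subst sum3_rot) (simp add: tri_rot)
  also have "(\<Sum>u\<in>V. \<Sum>w\<in>V. \<Sum>x\<in>V. tri u w x * ?M u x)
      = (\<Sum>u\<in>V. \<Sum>w\<in>V. \<Sum>x\<in>V. tri u w x * ?M u w)"
    by (subst sum3_rot[symmetric], subst sum3_rot[symmetric])
      (simp add: tri_rot symM flip: tri_rot)
  finally have "sum \<phi> V * tris (\<lambda>_. 1) \<le> 3 * (\<Sum>u\<in>V. \<Sum>w\<in>V. \<Sum>x\<in>V. tri u w x * ?M u w)"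
    by simp
  also have "(\<Sum>u\<in>V. \<Sum>w\<in>V. \<Sum>x\<in>V. tri u w x * ?M u w)
      = (\<Sum>u\<in>V. \<Sum>w\<in>V. (a u w * (\<Sum>x\<in>V. a u x * a w x)) * ?M u w)"
    by (simp add: tri_def sum_distrib_left sum_distrib_right mult_ac)
  also have "\<dots> \<le> (\<Sum>u\<in>V. \<Sum>w\<in>V. (a u w * b) * ?M u w)"
  proof (intro sum_mono mult_right_mono mono_wt_ge0 nn)
    fix u w assume "u \<in> V" "w \<in> V"
    then show "a u w * (\<Sum>x\<in>V. a u x * a w x) \<le> a u w * b"
      using a01[of u w] book[of u w] by auto
  qed
  also have "\<dots> = b * (\<Sum>u\<in>V. \<Sum>w\<in>V. a u w * ?M u w)"
    by (simp add: sum_distrib_left mult_ac)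
  finally show ?thesis by (simp add: sum_a_mono_wt)
qed

section \<open>Uniform weights: triangles against the number of edges\<close>

lemma nb_one: "nb (\<lambda>_. 1) = deg"
  by (simp add: nb_def deg_def fun_eq_iff)

lemma vol_sq_le: "vol\<^sup>2 \<le> real (card V) * (\<Sum>u\<in>V. deg u * deg u)"
  using Cauchy_Schwarz_ineq_sum[of "\<lambda>_. 1" deg V] by (simp add: vol_def power2_eq_square)

lemma deg_ge0: "0 \<le> deg u" and deg_le: "deg u \<le> real (card V)"
  unfolding deg_def using sum_mono[of V "a u" "\<lambda>_. 1"] by (auto intro: sum_nonneg)

lemma vol_ge0: "0 \<le> vol" and vol_le: "vol \<le> (real (card V))\<^sup>2"
  unfolding vol_def power2_eq_square using sum_mono[of V deg "\<lambda>_. real (card V)"] deg_le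
  by (auto intro: sum_nonneg deg_ge0)

text \<open>The case of constant weight 1 in \<open>tris_le\<close>: the triangle term on the right
  is absorbed on the left, producing \<open>n - 6 * b\<close>, and Cauchy-Schwarz bounds the sum of
  squared degrees from below.\<close>

lemma tris_le_unweighted:
  assumes "V \<noteq> {}" "0 \<le> b"
  shows "tris (\<lambda>_. 1) * (real (card V) - 6 * b) * real (card V)
    \<le> 3 * b * vol * ((real (card V))\<^sup>2 - 2 * vol)"
proof -
  let ?n = "real (card V)"
  have n: "0 < ?n" using assms fin by (simp add: card_gt_0_iff)
  have "tris (\<lambda>_. 1) * (?n - 6 * b) \<le> 3 * b * (?n * vol - 2 * (\<Sum>u\<in>V. deg u * deg u))"
    using tris_le[of "\<lambda>_. 1"] by (simp add: nb_one algebra_simps)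
  then have "tris (\<lambda>_. 1) * (?n - 6 * b) * ?n
      \<le> 3 * b * (?n * vol - 2 * (\<Sum>u\<in>V. deg u * deg u)) * ?n"
    using n by (intro mult_right_mono) auto
  also have "\<dots> = 3 * b * (?n\<^sup>2 * vol - 2 * (?n * (\<Sum>u\<in>V. deg u * deg u)))"
    by (simp add: algebra_simps power2_eq_square)
  also have "\<dots> \<le> 3 * b * (?n\<^sup>2 * vol - 2 * vol\<^sup>2)"
    using vol_sq_le assms by (intro mult_left_mono) auto
  finally show ?thesis by (simp add: algebra_simps power2_eq_square)
qed

section \<open>Spectral weights: triangles against the square of the eigenvalue\<close>

lemma nb_selfadj: "(\<Sum>u\<in>V. \<psi> u * nb \<phi> u) = (\<Sum>u\<in>V. \<phi> u * nb \<psi> u)"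
proof -
  have "(\<Sum>u\<in>V. \<psi> u * nb \<phi> u) = (\<Sum>u\<in>V. \<Sum>v\<in>V. \<psi> u * (a u v * \<phi> v))"
    by (simp add: nb_def sum_distrib_left)
  also have "\<dots> = (\<Sum>v\<in>V. \<Sum>u\<in>V. \<psi> u * (a u v * \<phi> v))" by (rule sum.swap)
  also have "\<dots> = (\<Sum>u\<in>V. \<phi> u * nb \<psi> u)"
    by (simp add: nb_def sum_distrib_left mult_ac sym)
  finally show ?thesis .
qed

lemma sum_nb: "(\<Sum>u\<in>V. nb \<phi> u) = (\<Sum>u\<in>V. \<phi> u * deg u)"
  using nb_selfadj[of "\<lambda>_. 1" \<phi>] by (simp add: nb_one)

text \<open>In a triangle of maximal weight the common neighbours of two vertices weigh at most as much
  as the third vertex.\<close>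

lemma triangle_weight_le:
  assumes nn: "\<And>v. v \<in> V \<Longrightarrow> 0 \<le> f v"
    and sub: "\<And>v. v \<in> V \<Longrightarrow> l * f v \<le> nb f v"
    and lb: "b < l"
    and T: "u \<in> V" "w \<in> V" "x \<in> V" "tri u w x = 1"
  shows "f u + f w + f x \<le> sum f V / (l - b)"
proof -
  let ?Ts = "{(u, w, x) \<in> V \<times> V \<times> V. tri u w x = 1}"
  let ?h = "\<lambda>(u, w, x). f u + f w + f x"
  have Ts: "finite ?Ts" by (rule finite_subset[of _ "V \<times> V \<times> V"]) (auto simp: fin)
  have "(u, w, x) \<in> ?Ts" using T by simp
  then have "Max (?h ` ?Ts) \<in> ?h ` ?Ts" by (intro Max_in finite_imageI Ts) blast
  then obtain m where m: "m \<in> ?Ts" "Max (?h ` ?Ts) = ?h m" by (rule imageE)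
  have "?h t \<le> ?h m" if "t \<in> ?Ts" for t
    unfolding m(2)[symmetric] by (intro Max_ge finite_imageI Ts imageI that)
  note m = m(1) this
  obtain p q r where pqr: "m = (p, q, r)" by (cases m)
  define s where "s = f p + f q + f r"
  have V: "p \<in> V" "q \<in> V" "r \<in> V" and tri: "tri p q r = 1" using m pqr by auto
  have e: "a p q = 1" "a q r = 1" "a p r = 1"
    using tri a01[of p q] a01[of q r] a01[of p r] by (auto simp: tri_def)
  have mx: "f i + f j + f k \<le> s" if "i \<in> V" "j \<in> V" "k \<in> V" "tri i j k = 1" for i j k
    using m(2)[of "(i, j, k)"] that by (simp add: pqr s_def)
  \<comment> \<open>Replacing \<open>k\<close> by a common neighbour \<open>y\<close> of
    \<open>i\<close> and \<open>j\<close> gives another triangle, of no larger weight, so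
    \<open>f y \<le> f k\<close>; there are at most \<open>b\<close> such \<open>y\<close>.\<close>
  have cw: "(\<Sum>y\<in>V. a i y * a j y * f y) \<le> b * f k"
    if "i \<in> V" "j \<in> V" "a i j = 1" "0 \<le> f k" "s = f i + f j + f k" for i j k
  proof -
    have "(\<Sum>y\<in>V. a i y * a j y * f y) \<le> (\<Sum>y\<in>V. a i y * a j y * f k)"
    proof (rule sum_mono)
      fix y assume y: "y \<in> V"
      show "a i y * a j y * f y \<le> a i y * a j y * f k"
      proof (cases "a i y * a j y = 0")
        case False
        then have "tri i j y = 1" using a01[of i y] a01[of j y] that by (auto simp: tri_def)
        from mx[OF that(1,2) y this] that have "f y \<le> f k" by simp
        then show ?thesis by (intro mult_left_mono) auto
      qed auto
    qed
    also have "\<dots> = (\<Sum>y\<in>V. a i y * a j y) * f k" by (simp add: sum_distrib_right)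
    also have "\<dots> \<le> b * f k" using book that by (intro mult_right_mono) auto
    finally show ?thesis .
  qed
  have "l * s \<le> nb f p + nb f q + nb f r"
    using sub[OF V(1)] sub[OF V(2)] sub[OF V(3)] by (simp add: s_def algebra_simps)
  also have "\<dots> = (\<Sum>y\<in>V. (a p y + a q y + a r y) * f y)"
    by (simp add: nb_def sum.distrib algebra_simps)
  \<comment> \<open>A vertex adjacent to j of the three triangle vertices satisfies j <= 1 + j (j -
    1) / 2, and the products count the pairs among these j.\<close>
  also have "\<dots> \<le> (\<Sum>y\<in>V. (1 + a p y * a q y + a q y * a r y + a p y * a r y) * f y)"
  proof (intro sum_mono mult_right_mono nn)
    fix y show "a p y + a q y + a r y \<le> 1 + a p y * a q y + a q y * a r y + a p y * a r y"
      using a01[of p y] a01[of q y] a01[of r y] by auto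
  qed
  also have "\<dots> = sum f V + (\<Sum>y\<in>V. a p y * a q y * f y) + (\<Sum>y\<in>V. a q y * a r y * f y)
      + (\<Sum>y\<in>V. a p y * a r y * f y)"
    by (simp add: sum.distrib algebra_simps)
  also have "\<dots> \<le> sum f V + b * f r + b * f p + b * f q"
    using cw[of p q r] cw[of q r p] cw[of p r q] V e nn by (simp add: s_def)
  finally have "(l - b) * s \<le> sum f V" by (simp add: s_def algebra_simps)
  then have "s \<le> sum f V / (l - b)" using lb by (simp add: pos_le_divide_eq mult.commute)
  then show ?thesis using mx[OF T] by simp
qed

text \<open>Adding the three rotations charges each triangle the weights of all its vertices, a
  total that \<open>triangle_weight_le\<close> bounds uniformly.\<close>

lemma tris_weighted_le:
  assumes nn: "\<And>v. v \<in> V \<Longrightarrow> 0 \<le> f v"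
    and sub: "\<And>v. v \<in> V \<Longrightarrow> l * f v \<le> nb f v"
    and lb: "b < l"
  shows "3 * tris f \<le> tris (\<lambda>_. 1) * (sum f V / (l - b))"
proof -
  have 1: "tris f = (\<Sum>u\<in>V. \<Sum>w\<in>V. \<Sum>x\<in>V. tri u w x * f w)"
    unfolding tris_def by (subst sum3_rot) (simp add: tri_rot)
  have 2: "tris f = (\<Sum>u\<in>V. \<Sum>w\<in>V. \<Sum>x\<in>V. tri u w x * f u)"
    unfolding 1 by (subst sum3_rot) (simp add: tri_rot)
  have "3 * tris f = (\<Sum>u\<in>V. \<Sum>w\<in>V. \<Sum>x\<in>V. tri u w x * f u)
      + (\<Sum>u\<in>V. \<Sum>w\<in>V. \<Sum>x\<in>V. tri u w x * f w) + (\<Sum>u\<in>V. \<Sum>w\<in>V. \<Sum>x\<in>V. tri u w x * f x)"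
    using 1 2 by (simp add: tris_def)
  also have "\<dots> = (\<Sum>u\<in>V. \<Sum>w\<in>V. \<Sum>x\<in>V. tri u w x * (f u + f w + f x))"
    by (simp add: sum.distrib distrib_left)
  also have "\<dots> \<le> (\<Sum>u\<in>V. \<Sum>w\<in>V. \<Sum>x\<in>V. tri u w x * (sum f V / (l - b)))"
  proof (intro sum_mono)
    fix u w x assume V: "u \<in> V" "w \<in> V" "x \<in> V"
    have "tri u w x = 0 \<or> tri u w x = 1"
      using a01[of u w] a01[of w x] a01[of u x] by (auto simp: tri_def)
    then show "tri u w x * (f u + f w + f x) \<le> tri u w x * (sum f V / (l - b))"
      using triangle_weight_le[OF nn sub lb V] by auto
  qed
  also have "\<dots> = tris (\<lambda>_. 1) * (sum f V / (l - b))"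
    by (simp only: tris_def sum_distrib_right mult_1_right)
  finally show ?thesis .
qed

text \<open>This is \<open>tris_le\<close> with \<open>f\<close> as the weight: two uses of
  \<open>sub\<close> bound the degree term below by \<open>l\<^sup>2 * sum f V\<close>, and
  \<open>tris_weighted_le\<close> controls the triangle term.\<close>

lemma tris_le_spectral:
  assumes nn: "\<And>v. v \<in> V \<Longrightarrow> 0 \<le> f v"
    and sub: "\<And>v. v \<in> V \<Longrightarrow> l * f v \<le> nb f v"
    and S: "0 < sum f V" and b: "0 \<le> b" "b < l"
  shows "tris (\<lambda>_. 1) * (l - 3 * b) \<le> 3 * b * (vol - 2 * l\<^sup>2) * (l - b)"
proof -
  let ?S = "sum f V" and ?t = "tris (\<lambda>_. 1)"
  have "l * (l * ?S) \<le> l * (\<Sum>u\<in>V. nb f u)"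
    using b by (intro mult_left_mono) (auto simp: sum_distrib_left intro: sum_mono sub)
  also have "\<dots> = (\<Sum>u\<in>V. l * f u * deg u)" by (simp add: sum_nb sum_distrib_left mult_ac)
  also have "\<dots> \<le> (\<Sum>u\<in>V. deg u * nb f u)"
  proof (rule sum_mono)
    fix u assume "u \<in> V"
    then show "l * f u * deg u \<le> deg u * nb f u"
      by (subst mult.commute) (intro mult_left_mono sub deg_ge0)
  qed
  finally have 1: "l\<^sup>2 * ?S \<le> (\<Sum>u\<in>V. deg u * nb f u)" by (simp add: power2_eq_square mult_ac)
  define q where "q = ?t * (?S / (l - b))"
  have 2: "3 * tris f \<le> q" unfolding q_def by (rule tris_weighted_le[OF nn sub b(2)])
  have "?S * ?t \<le> 3 * b * (?S * vol - 2 * (\<Sum>u\<in>V. deg u * nb f u) + 2 * tris f)"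
    by (rule tris_le[OF nn])
  also have "\<dots> \<le> 3 * b * (?S * vol - 2 * (l\<^sup>2 * ?S) + 2 * (q / 3))"
    using 1 2 b(1) by (intro mult_left_mono) linarith+
  also have "\<dots> = 3 * b * (?S * vol - 2 * (l\<^sup>2 * ?S)) + 2 * b * q" by (simp add: algebra_simps)
  also have "\<dots> = ?S * (3 * b * (vol - 2 * l\<^sup>2) + 2 * b * ?t / (l - b))"
    by (simp add: q_def algebra_simps)
  finally have "?t \<le> 3 * b * (vol - 2 * l\<^sup>2) + 2 * b * ?t / (l - b)"
    using S by (simp add: mult_le_cancel_left_pos)
  \<comment> \<open>Clearing the denominator leaves \<open>2 * b * ?t\<close> on the right; moved to
    the left it turns \<open>l - b\<close> into \<open>l - 3 * b\<close>.\<close>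
  then have "?t * (l - b) \<le> 3 * b * (vol - 2 * l\<^sup>2) * (l - b) + 2 * b * ?t"
    using b by (simp add: field_simps)
  then show ?thesis by (simp add: algebra_simps)
qed

section \<open>The triangle-free case: nearly constant weights and many edges\<close>

text \<open>Adjacent vertices have disjoint neighbourhoods, so \<open>nb f u + nb f w\<close> is at
  most \<open>sum f V\<close> on edges. Averaging this over edges with weights
  \<open>f u * f w\<close> and applying Cauchy-Schwarz gives
  \<open>2 * J \<le> (sum f V)\<^sup>2\<close> for the quadratic form \<open>J\<close> of the
  adjacency kernel, the Motzkin-Straus bound for clique number two; and \<open>J\<close> is at least
  \<open>l\<close> times the squared norm.\<close>

lemma norm_sq_le_of_triangle_free:
  assumes nn: "\<And>v. v \<in> V \<Longrightarrow> 0 \<le> f v"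
    and sub: "\<And>v. v \<in> V \<Longrightarrow> l * f v \<le> nb f v"
    and S: "0 < sum f V" and l: "0 < l" and t0: "tris (\<lambda>_. 1) = 0"
  shows "2 * l * (\<Sum>u\<in>V. (f u)\<^sup>2) \<le> (sum f V)\<^sup>2"
proof -
  let ?S = "sum f V" and ?g = "nb f" and ?N = "\<Sum>u\<in>V. (f u)\<^sup>2"
  define J where "J = (\<Sum>u\<in>V. f u * ?g u)"
  have tri0: "tri u w x = 0" if "u \<in> V" "w \<in> V" "x \<in> V" for u w x
  proof -
    have "(\<Sum>w\<in>V. \<Sum>x\<in>V. tri u w x) = 0"
      using t0 that fin by (auto simp: tris_def sum_nonneg_eq_0_iff sum_nonneg)
    then have "(\<Sum>x\<in>V. tri u w x) = 0"
      using that fin by (auto simp: sum_nonneg_eq_0_iff sum_nonneg)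
    then show ?thesis using that fin by (auto simp: sum_nonneg_eq_0_iff)
  qed
  have edge: "a u w * (?g u + ?g w) \<le> a u w * ?S" if "u \<in> V" "w \<in> V" for u w
  proof (cases "a u w = 0")
    case False
    have "a u x + a w x \<le> 1" if "x \<in> V" for x
      using tri0[OF \<open>u \<in> V\<close> \<open>w \<in> V\<close> that] False a01[of u x] a01[of w x]
      by (auto simp: tri_def)
    then have "(\<Sum>x\<in>V. (a u x + a w x) * f x) \<le> (\<Sum>x\<in>V. 1 * f x)"
      by (intro sum_mono mult_right_mono nn) auto
    then have "?g u + ?g w \<le> ?S" by (simp add: nb_def sum.distrib algebra_simps)
    then show ?thesis by (intro mult_left_mono) auto
  qed auto
  have "(\<Sum>u\<in>V. \<Sum>w\<in>V. f u * f w * (a u w * (?g u + ?g w)))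
      = (\<Sum>u\<in>V. \<Sum>w\<in>V. f u * ?g u * (a u w * f w))
        + (\<Sum>u\<in>V. \<Sum>w\<in>V. f u * (a u w * (f w * ?g w)))"
    by (simp add: algebra_simps sum.distrib)
  also have "\<dots> = (\<Sum>u\<in>V. f u * ?g u * ?g u) + (\<Sum>u\<in>V. f u * nb (\<lambda>w. f w * ?g w) u)"
    by (simp add: nb_def sum_distrib_left)
  also have "\<dots> = 2 * (\<Sum>u\<in>V. f u * (?g u)\<^sup>2)"
    by (subst nb_selfadj) (simp add: power2_eq_square mult_ac)
  finally have L: "(\<Sum>u\<in>V. \<Sum>w\<in>V. f u * f w * (a u w * (?g u + ?g w)))
      = 2 * (\<Sum>u\<in>V. f u * (?g u)\<^sup>2)" .
  have "(\<Sum>u\<in>V. \<Sum>w\<in>V. f u * f w * (a u w * (?g u + ?g w)))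
      \<le> (\<Sum>u\<in>V. \<Sum>w\<in>V. f u * f w * (a u w * ?S))"
    by (intro sum_mono mult_left_mono edge mult_nonneg_nonneg nn)
  also have "\<dots> = ?S * J"
    by (simp add: J_def nb_def sum_distrib_left mult_ac)
  finally have up: "2 * (\<Sum>u\<in>V. f u * (?g u)\<^sup>2) \<le> ?S * J" using L by simp
  \<comment> \<open>Each factor \<open>f u\<close> is split into two square roots, so that
    Cauchy-Schwarz yields the sum bounded in \<open>up\<close>.\<close>
  have "J\<^sup>2 = (\<Sum>u\<in>V. sqrt (f u) * (sqrt (f u) * ?g u))\<^sup>2"
    unfolding J_def by (intro arg_cong[where f = "\<lambda>x. x\<^sup>2"] sum.cong refl)
      (simp add: nn flip: mult.assoc)
  also have "\<dots> \<le> (\<Sum>u\<in>V. (sqrt (f u))\<^sup>2) * (\<Sum>u\<in>V. (sqrt (f u) * ?g u)\<^sup>2)"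
    by (rule Cauchy_Schwarz_ineq_sum)
  also have "\<dots> = ?S * (\<Sum>u\<in>V. f u * (?g u)\<^sup>2)"
    by (simp add: nn power_mult_distrib)
  finally have "2 * J\<^sup>2 \<le> ?S * (2 * (\<Sum>u\<in>V. f u * (?g u)\<^sup>2))" by simp
  also have "\<dots> \<le> ?S * (?S * J)" using up S by (intro mult_left_mono) auto
  finally have J2: "2 * J * J \<le> ?S\<^sup>2 * J" by (simp add: power2_eq_square mult_ac)
  have JN: "l * ?N \<le> J"
    unfolding J_def sum_distrib_left power2_eq_square
    by (rule sum_mono) (metis mult.left_commute mult_left_mono nn sub)
  have "0 < ?N"
  proof -
    have "\<exists>u\<in>V. 0 < f u" using S by (meson not_le sum_nonpos)
    then show ?thesis using fin by (auto intro: sum_pos2)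
  qed
  then have "0 < J" using JN l by (smt (verit) mult_pos_pos)
  then have "2 * J \<le> ?S\<^sup>2" using J2 by simp
  then show ?thesis using JN by simp
qed

text \<open>The hypothesis \<open>N\<close> is near-equality in Cauchy-Schwarz: \<open>f\<close>
  deviates from its mean by at most \<open>z\<close> times the mean in root mean square. Hence the
  \<open>f\<close>-weighted degree sum, which is at least \<open>l * sum f V\<close>, is close to
  the unweighted one.\<close>

lemma vol_ge_of_norm_sq_le:
  assumes sub: "\<And>v. v \<in> V \<Longrightarrow> l * f v \<le> nb f v"
    and S: "0 < sum f V" and z: "0 \<le> z"
    and N: "real (card V) * (\<Sum>u\<in>V. (f u)\<^sup>2) \<le> (1 + z\<^sup>2) * (sum f V)\<^sup>2"
  shows "l * real (card V) - z * (real (card V))\<^sup>2 \<le> vol"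
proof -
  let ?n = "real (card V)" and ?S = "sum f V" and ?N = "\<Sum>u\<in>V. (f u)\<^sup>2"
  have n: "0 < ?n" using S fin by (auto simp: card_gt_0_iff)
  \<comment> \<open>\<open>X\<close> is the error made when \<open>n * f\<close> is replaced by the
    constant \<open>?S\<close> against the degrees.\<close>
  define X where "X = (\<Sum>u\<in>V. (?n * f u - ?S) * deg u)"
  have "(\<Sum>u\<in>V. (?n * f u - ?S)\<^sup>2) = (\<Sum>u\<in>V. ?n\<^sup>2 * (f u)\<^sup>2 - 2 * ?n * ?S * f u + ?S\<^sup>2)"
    by (simp add: power2_diff power_mult_distrib algebra_simps)
  also have "\<dots> = ?n\<^sup>2 * ?N - 2 * ?n * ?S * ?S + ?n * ?S\<^sup>2"
    by (simp only: sum.distrib sum_subtractf sum_distrib_left[symmetric]) simp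
  also have "\<dots> = ?n * (?n * ?N - ?S\<^sup>2)" by (simp add: algebra_simps power2_eq_square)
  also have "\<dots> \<le> ?n * (z\<^sup>2 * ?S\<^sup>2)" using N n by (intro mult_left_mono) (auto simp: algebra_simps)
  finally have v: "(\<Sum>u\<in>V. (?n * f u - ?S)\<^sup>2) \<le> ?n * (z\<^sup>2 * ?S\<^sup>2)" .
  have d: "(\<Sum>u\<in>V. (deg u)\<^sup>2) \<le> ?n * ?n\<^sup>2"
    using sum_mono[of V "\<lambda>u. (deg u)\<^sup>2" "\<lambda>_. ?n\<^sup>2"] deg_ge0 deg_le by (auto intro: power_mono)
  have "X\<^sup>2 \<le> (\<Sum>u\<in>V. (?n * f u - ?S)\<^sup>2) * (\<Sum>u\<in>V. (deg u)\<^sup>2)"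
    unfolding X_def by (rule Cauchy_Schwarz_ineq_sum)
  also have "\<dots> \<le> (?n * (z\<^sup>2 * ?S\<^sup>2)) * (?n * ?n\<^sup>2)"
    using v d by (intro mult_mono) (auto intro: sum_nonneg)
  also have "\<dots> = (?n\<^sup>2 * z * ?S)\<^sup>2" by (simp add: power2_eq_square)
  finally have X: "X \<le> ?n\<^sup>2 * z * ?S"
    by (rule power2_le_imp_le) (use z S in \<open>intro mult_nonneg_nonneg; simp\<close>)
  have "l * ?S \<le> (\<Sum>u\<in>V. f u * deg u)"
    unfolding sum_nb[symmetric] sum_distrib_left by (intro sum_mono sub)
  then have "?n * (l * ?S) \<le> ?n * (\<Sum>u\<in>V. f u * deg u)" using n by (intro mult_left_mono) auto
  also have "\<dots> = X + ?S * vol"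
    by (simp add: X_def vol_def algebra_simps sum_subtractf sum_distrib_left)
  finally have "?S * (l * ?n) \<le> ?S * (?n\<^sup>2 * z + vol)" using X by (simp add: algebra_simps)
  then show ?thesis using S by (simp add: mult_le_cancel_left_pos mult.commute)
qed

section \<open>Many edges, few triangles, and a nearly bipartite cut\<close>

text \<open>Some \<open>v\<close> does no worse than the average over all cuts, which
  \<open>sum_a_mono_wt\<close> computes for constant weight 1.\<close>

lemma ex_cut_few_mono:
  assumes "V \<noteq> {}"
  obtains v where "v \<in> V"
    "(real (card V))\<^sup>2 * (\<Sum>u\<in>V. \<Sum>w\<in>V. a u w * mono_ind v u w)
       \<le> (real (card V))\<^sup>2 * vol - 2 * vol\<^sup>2 + 2 * real (card V) * tris (\<lambda>_. 1)"
proof -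
  let ?n = "real (card V)"
  let ?I = "\<lambda>v. \<Sum>u\<in>V. \<Sum>w\<in>V. a u w * mono_ind v u w"
  have n: "0 < ?n" using assms fin by (simp add: card_gt_0_iff)
  have "(\<Sum>v\<in>V. ?I v) = (\<Sum>u\<in>V. \<Sum>v\<in>V. \<Sum>w\<in>V. a u w * mono_ind v u w)"
    by (rule sum.swap)
  also have "\<dots> = (\<Sum>u\<in>V. \<Sum>w\<in>V. \<Sum>v\<in>V. a u w * mono_ind v u w)"
    by (rule sum.cong[OF refl], rule sum.swap)
  also have "\<dots> = (\<Sum>u\<in>V. \<Sum>w\<in>V. a u w * mono_wt (\<lambda>_. 1) u w)"
    by (simp add: mono_wt_def sum_distrib_left)
  finally have I: "(\<Sum>v\<in>V. ?I v)
      = ?n * vol - 2 * (\<Sum>u\<in>V. deg u * deg u) + 2 * tris (\<lambda>_. 1)"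
    by (simp add: sum_a_mono_wt nb_one)
  define R where "R = ?n\<^sup>2 * vol - 2 * vol\<^sup>2 + 2 * ?n * tris (\<lambda>_. 1)"
  have "?n * (\<Sum>v\<in>V. ?I v) \<le> R"
    using vol_sq_le unfolding I R_def by (simp add: algebra_simps power2_eq_square)
  moreover have "\<exists>v\<in>V. ?n\<^sup>2 * ?I v \<le> R"
  proof (rule ccontr)
    assume "\<not> ?thesis"
    then have "(\<Sum>v\<in>V. R) < (\<Sum>v\<in>V. ?n\<^sup>2 * ?I v)"
      using assms fin by (intro sum_strict_mono) auto
    also have "\<dots> = ?n * (?n * (\<Sum>v\<in>V. ?I v))"
      by (simp add: sum_distrib_left power2_eq_square mult_ac)
    finally show False using \<open>?n * (\<Sum>v\<in>V. ?I v) \<le> R\<close> n by simp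
  qed
  ultimately show thesis using that unfolding R_def by blast
qed

text \<open>Dichotomy on \<open>vol \<le> 2 * l\<^sup>2\<close>. If it holds, the spectral bound
  excludes triangles and the nearly constant \<open>f\<close> gives many edges; otherwise there are
  many edges outright and the unweighted bound limits the triangles.\<close>

lemma vol_tris_bounds:
  assumes nn: "\<And>v. v \<in> V \<Longrightarrow> 0 \<le> f v"
    and sub: "\<And>v. v \<in> V \<Longrightarrow> l * f v \<le> nb f v"
    and S: "0 < sum f V" and b: "0 \<le> b" "b \<le> (1 / 6 - \<epsilon>) * real (card V)"
    and z: "0 < z" "z \<le> 1 / 4" "z \<le> \<epsilon>"
    and l: "(1 / 2 - z\<^sup>2) * real (card V) \<le> l"
  shows "(1 / 2 - 3 * z) * (real (card V))\<^sup>2 \<le> vol"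
    and "tris (\<lambda>_. 1) \<le> z * (real (card V)) ^ 3"
proof -
  let ?n = "real (card V)" and ?t = "tris (\<lambda>_. 1)" and ?N = "\<Sum>u\<in>V. (f u)\<^sup>2"
  have V: "V \<noteq> {}" using S by auto
  then have n: "0 < ?n" using fin by (simp add: card_gt_0_iff)
  have zz: "z\<^sup>2 \<le> z / 4" using z by (simp add: power2_eq_square)
  have "z\<^sup>2 * ?n \<le> \<epsilon> / 4 * ?n" using zz z n by (intro mult_right_mono) auto
  moreover have "0 < \<epsilon> * ?n" using z n by (intro mult_pos_pos) auto
  \<comment> \<open>Here 3 b <= (1/2 - 3 \<epsilon>) n, while l falls short of n/2 by at most
    \<epsilon> n / 4.\<close>
  ultimately have gap: "0 < l - 3 * b" using b(2) l unfolding left_diff_distrib by linarith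
  have bl: "b < l" using gap b by linarith
  have "0 < l" using bl b by linarith
  have l2: "(1 - 2 * z\<^sup>2) * ?n \<le> 2 * l" using l by (simp add: algebra_simps)
  have "(1 / 2 - 3 * z) * ?n\<^sup>2 \<le> vol \<and> ?t \<le> z * ?n ^ 3"
  proof (cases "vol \<le> 2 * l\<^sup>2")
    case True
    have "?t * (l - 3 * b) \<le> 3 * b * (vol - 2 * l\<^sup>2) * (l - b)"
      by (rule tris_le_spectral[OF nn sub S b(1) bl])
    also have "\<dots> \<le> 0" using True b bl by (intro mult_nonpos_nonneg mult_nonneg_nonpos) auto
    finally have "?t \<le> 0" using gap by (simp add: mult_le_0_iff)
    then have t0: "?t = 0" using tris_ge0 by linarith
    \<comment> \<open>This turns the norm bound, in which 2 l is nearly n, into the hypothesis of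
      \<open>vol_ge_of_norm_sq_le\<close> with \<open>2 * z\<close> as its parameter.\<close>
    have "1 \<le> (1 - 2 * z\<^sup>2) * (1 + (2 * z)\<^sup>2)"
    proof -
      have "0 \<le> 2 * z\<^sup>2 * (1 - 4 * z\<^sup>2)" using zz z by (intro mult_nonneg_nonneg) auto
      then show ?thesis by (simp add: algebra_simps power2_eq_square)
    qed
    then have "1 * ?n \<le> (1 - 2 * z\<^sup>2) * (1 + (2 * z)\<^sup>2) * ?n" by (rule mult_right_mono) simp
    also have "\<dots> = (1 + (2 * z)\<^sup>2) * ((1 - 2 * z\<^sup>2) * ?n)" by simp
    also have "\<dots> \<le> (1 + (2 * z)\<^sup>2) * (2 * l)" by (intro mult_left_mono l2) simp
    finally have "1 * ?n * ?N \<le> (1 + (2 * z)\<^sup>2) * (2 * l) * ?N"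
      by (intro mult_right_mono sum_nonneg) auto
    also have "\<dots> = (1 + (2 * z)\<^sup>2) * (2 * l * ?N)" by simp
    also have "\<dots> \<le> (1 + (2 * z)\<^sup>2) * (sum f V)\<^sup>2"
      by (intro mult_left_mono norm_sq_le_of_triangle_free[OF nn sub S \<open>0 < l\<close> t0]) auto
    finally have "l * ?n - 2 * z * ?n\<^sup>2 \<le> vol"
      using vol_ge_of_norm_sq_le[OF sub S, of "2 * z"] z by simp
    moreover have "(1 / 2 - z\<^sup>2) * ?n * ?n \<le> l * ?n" by (intro mult_right_mono l) simp
    moreover have "z\<^sup>2 * ?n\<^sup>2 \<le> z * ?n\<^sup>2" using zz z by (intro mult_right_mono) auto
    ultimately have "(1 / 2 - 3 * z) * ?n\<^sup>2 \<le> vol" by (simp add: algebra_simps power2_eq_square)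
    then show ?thesis using t0 z by simp
  next
    case False
    have "((1 - 2 * z\<^sup>2) * ?n)\<^sup>2 \<le> (2 * l)\<^sup>2"
      using zz z by (intro power_mono l2 mult_nonneg_nonneg) auto
    then have "(1 - 2 * z\<^sup>2)\<^sup>2 * ?n\<^sup>2 \<le> 2 * vol" using False by (simp add: power_mult_distrib)
    moreover have "(1 - 4 * z\<^sup>2) * ?n\<^sup>2 \<le> (1 - 2 * z\<^sup>2)\<^sup>2 * ?n\<^sup>2"
      by (intro mult_right_mono) (simp_all add: power2_diff)
    \<comment> \<open>The deficit is quadratic in \<open>z\<close>: after division by
      \<open>6 * \<epsilon> * n\<close>, a lower bound for \<open>n - 6 * b\<close>, it still leaves
      a triangle bound linear in \<open>z\<close>, since \<open>z \<le> \<epsilon>\<close>.\<close>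
    ultimately have vol: "?n\<^sup>2 - 2 * vol \<le> 4 * z\<^sup>2 * ?n\<^sup>2" by (simp add: algebra_simps)
    have "\<epsilon> * ?n \<ge> 0" using z n by (intro mult_nonneg_nonneg) auto
    then have bn: "b \<le> ?n / 6" using b by (simp add: algebra_simps)
    have "?t * (6 * \<epsilon> * ?n) * ?n \<le> ?t * (?n - 6 * b) * ?n"
      using b tris_ge0 by (intro mult_right_mono mult_left_mono) (auto simp: algebra_simps)
    also have "\<dots> \<le> 3 * b * vol * (?n\<^sup>2 - 2 * vol)" by (rule tris_le_unweighted[OF V b(1)])
    also have "\<dots> \<le> 3 * b * vol * (4 * z\<^sup>2 * ?n\<^sup>2)"
      using b vol_ge0 vol by (intro mult_left_mono) auto
    also have "\<dots> \<le> 3 * (?n / 6) * ?n\<^sup>2 * (4 * z\<^sup>2 * ?n\<^sup>2)"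
      using b bn vol_le vol_ge0 by (intro mult_right_mono mult_mono) auto
    also have "\<dots> = (6 * ?n\<^sup>2) * (z * z * ?n ^ 3 / 3)" by (simp add: eval_nat_numeral)
    finally have "(6 * ?n\<^sup>2) * (?t * \<epsilon>) \<le> (6 * ?n\<^sup>2) * (z * z * ?n ^ 3 / 3)"
      by (simp add: power2_eq_square mult_ac)
    then have "?t * \<epsilon> \<le> z * z * ?n ^ 3 / 3"
      by (rule mult_left_le_imp_le) (use n in simp)
    also have "\<dots> \<le> z * \<epsilon> * ?n ^ 3"
    proof -
      have "z * z * ?n ^ 3 \<le> z * \<epsilon> * ?n ^ 3" using z by (intro mult_right_mono mult_left_mono) auto
      moreover have "0 \<le> z * z * ?n ^ 3" by simp
      ultimately show ?thesis by linarith
    qed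
    finally have "?t \<le> z * ?n ^ 3" using z by (simp add: mult_ac mult_le_cancel_left_pos)
    moreover have "4 * z\<^sup>2 * ?n\<^sup>2 \<le> 6 * z * ?n\<^sup>2" using zz z by (intro mult_right_mono) auto
    ultimately show ?thesis using vol by (simp add: algebra_simps)
  qed
  then show "(1 / 2 - 3 * z) * ?n\<^sup>2 \<le> vol" "?t \<le> z * ?n ^ 3" by auto
qed

lemma ex_small_near_cut:
  assumes V: "V \<noteq> {}" and z: "0 \<le> z"
    and vol: "(1 / 2 - 3 * z) * (real (card V))\<^sup>2 \<le> vol"
    and t: "tris (\<lambda>_. 1) \<le> z * (real (card V)) ^ 3"
  obtains X where "X \<subseteq> V" "2 * card X \<le> card V"
    "(\<Sum>u\<in>V. \<Sum>w\<in>V. \<bar>a u w - of_bool ((u \<in> X) \<noteq> (w \<in> X))\<bar>) \<le> 19 * z * (real (card V))\<^sup>2"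
    "(real (card V) - 2 * real (card X))\<^sup>2 \<le> 22 * z * (real (card V))\<^sup>2"
proof -
  let ?n = "real (card V)"
  have n: "0 < ?n" using V fin by (simp add: card_gt_0_iff)
  obtain v where v: "v \<in> V" and
    I: "?n\<^sup>2 * (\<Sum>u\<in>V. \<Sum>w\<in>V. a u w * mono_ind v u w) \<le> ?n\<^sup>2 * vol - 2 * vol\<^sup>2 + 2 * ?n * tris (\<lambda>_. 1)"
    by (rule ex_cut_few_mono[OF V])
  define I where "I = (\<Sum>u\<in>V. \<Sum>w\<in>V. a u w * mono_ind v u w)"
  have "?n\<^sup>2 * I \<le> vol * (?n\<^sup>2 - 2 * vol) + 2 * ?n * tris (\<lambda>_. 1)"
    using I by (simp add: I_def algebra_simps power2_eq_square)
  also have "\<dots> \<le> vol * (6 * z * ?n\<^sup>2) + 2 * ?n * (z * ?n ^ 3)"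
    using vol vol_ge0 t by (intro add_mono mult_left_mono) (auto simp: algebra_simps)
  also have "\<dots> \<le> ?n\<^sup>2 * (6 * z * ?n\<^sup>2) + 2 * ?n * (z * ?n ^ 3)"
    using vol_le z by (intro add_right_mono mult_right_mono) auto
  also have "\<dots> = ?n\<^sup>2 * (8 * z * ?n\<^sup>2)" by (simp add: eval_nat_numeral)
  finally have I: "I \<le> 8 * z * ?n\<^sup>2" using n by (simp add: mult_le_cancel_left_pos)
  define N where "N = {w \<in> V. a v w = 1}"
  \<comment> \<open>The smaller side is taken so that it can later be enlarged to half of the
    vertices.\<close>
  define X where "X = (if 2 * card N \<le> card V then N else V - N)"
  have XV: "X \<subseteq> V" by (auto simp: X_def N_def)
  have "card (V - N) = card V - card N" "card N \<le> card V"
    using fin by (auto simp: N_def intro!: card_Diff_subset card_mono)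
  then have "2 * card N \<le> card V \<or> 2 * card (V - N) \<le> card V" by linarith
  then have X2: "2 * card X \<le> card V" by (auto simp: X_def)
  define k :: "'a \<Rightarrow> 'a \<Rightarrow> real" where "k u w = of_bool ((u \<in> X) \<noteq> (w \<in> X))" for u w
  have k: "mono_ind v u w = 1 - k u w" if "u \<in> V" "w \<in> V" for u w
    using that a01[of v u] a01[of v w] by (auto simp: mono_ind_def k_def X_def N_def)
  let ?K = "\<Sum>u\<in>V. \<Sum>w\<in>V. k u w"
  \<comment> \<open>In \<open>k - a\<close> a missing crossing pair counts +1 and an edge within a
    side counts -1; adding the latter twice corrects its sign.\<close>
  have "(\<Sum>u\<in>V. \<Sum>w\<in>V. \<bar>a u w - k u w\<bar>)
      = (\<Sum>u\<in>V. \<Sum>w\<in>V. k u w - a u w + 2 * (a u w * mono_ind v u w))"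
  proof (intro sum.cong refl)
    fix u w assume "u \<in> V" "w \<in> V"
    then show "\<bar>a u w - k u w\<bar> = k u w - a u w + 2 * (a u w * mono_ind v u w)"
      using a01[of u w] by (auto simp: k k_def)
  qed
  also have "\<dots> = ?K - vol + 2 * I"
    by (simp add: sum.distrib sum_subtractf I_def vol_def deg_def flip: sum_distrib_left)
  finally have D: "(\<Sum>u\<in>V. \<Sum>w\<in>V. \<bar>a u w - k u w\<bar>) = ?K - vol + 2 * I" .
  have "vol - I = (\<Sum>u\<in>V. \<Sum>w\<in>V. a u w * k u w)"
    by (simp add: vol_def deg_def I_def k algebra_simps sum_subtractf)
  also have "\<dots> \<le> ?K"
    by (intro sum_mono) (simp add: k_def)
  finally have KI: "vol - I \<le> ?K" .
  have k_eq: "k u w = of_bool (u \<in> X) + of_bool (w \<in> X) - 2 * of_bool (u \<in> X) * of_bool (w \<in> X)" for u w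
    by (simp add: k_def)
  have cX: "(\<Sum>u\<in>V. of_bool (u \<in> X)) = real (card X)"
    using fin XV by (simp add: sum.If_cases of_bool_def Int_absorb1)
  have "?K = 2 * ?n * real (card X) - 2 * (real (card X))\<^sup>2"
    unfolding k_eq
    by (simp add: sum.distrib sum_subtractf cX power2_eq_square flip: sum_distrib_left sum_distrib_right)
  then have K: "2 * ?K = ?n\<^sup>2 - (?n - 2 * real (card X))\<^sup>2"
    by (simp add: power2_eq_square algebra_simps)
  show thesis
  \<comment> \<open>From 2 \<open>?K\<close> <= n^2, \<open>vol\<close> >= (1/2 - 3 z) n^2 and
    \<open>I\<close> <= 8 z n^2, the distance is at most (3 + 16) z n^2. The imbalance squared is
    n^2 - 2 \<open>?K\<close> <= n^2 - 2 \<open>vol\<close> + 2 \<open>I\<close>, at most (6 + 16) z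
    n^2.\<close>
  proof (rule that[OF XV X2])
    have "2 * ?K \<le> ?n\<^sup>2" using K by simp
    then show "(\<Sum>u\<in>V. \<Sum>w\<in>V. \<bar>a u w - of_bool ((u \<in> X) \<noteq> (w \<in> X))\<bar>) \<le> 19 * z * ?n\<^sup>2"
      using D I vol unfolding k_def by (simp add: algebra_simps)
    show "(?n - 2 * real (card X))\<^sup>2 \<le> 22 * z * ?n\<^sup>2"
      using K KI I vol by (simp add: algebra_simps)
  qed
qed

end

section \<open>From ordered pairs to edge sets, spectral radius and booksize\<close>

lemma sum_of_bool_pairs:
  assumes "finite V" and D: "D \<subseteq> {e. e \<subseteq> V \<and> card e = 2}"
  shows "(\<Sum>u\<in>V. \<Sum>w\<in>V. of_bool ({u, w} \<in> D)) = 2 * real (card D)"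
proof -
  have "finite D" by (rule finite_subset[OF D]) (simp add: assms(1))
  have two: "(\<Sum>u\<in>V. \<Sum>w\<in>V. of_bool ({u, w} = e)) = (2 :: real)" if "e \<in> D" for e
  proof -
    obtain x y where e: "e = {x, y}" "x \<noteq> y" "x \<in> V" "y \<in> V"
      using D \<open>e \<in> D\<close> by (auto simp: card_2_iff)
    have "of_bool ({u, w} = e)
        = of_bool (u = x) * of_bool (w = y) + of_bool (u = y) * (of_bool (w = x) :: real)" for u w
      using e by (auto simp: doubleton_eq_iff)
    then have "(\<Sum>u\<in>V. \<Sum>w\<in>V. of_bool ({u, w} = e))
        = (\<Sum>u\<in>V. of_bool (u = x)) * (\<Sum>w\<in>V. of_bool (w = y))
          + (\<Sum>u\<in>V. of_bool (u = y)) * (\<Sum>w\<in>V. of_bool (w = x) :: real)"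
      by (simp only: sum.distrib sum_product)
    then show ?thesis using e assms(1) by (simp add: of_bool_def)
  qed
  have "(\<Sum>u\<in>V. \<Sum>w\<in>V. of_bool ({u, w} \<in> D))
      = (\<Sum>u\<in>V. \<Sum>w\<in>V. \<Sum>e\<in>D. of_bool ({u, w} = e) :: real)"
    using \<open>finite D\<close> by (simp add: of_bool_def)
  also have "\<dots> = (\<Sum>u\<in>V. \<Sum>e\<in>D. \<Sum>w\<in>V. of_bool ({u, w} = e))"
    by (rule sum.cong[OF refl], rule sum.swap)
  also have "\<dots> = (\<Sum>e\<in>D. \<Sum>u\<in>V. \<Sum>w\<in>V. of_bool ({u, w} = e))"
    by (rule sum.swap)
  also have "\<dots> = 2 * real (card D)" by (simp add: two)
  finally show ?thesis .
qed

text \<open>\<open>X\<close> is enlarged to a set \<open>A\<close> of half the vertices. This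
  affects only ordered pairs meeting \<open>A - X\<close>, at most 2 n (|A| - |X|) <= n (n - 2 |X|)
  of them.\<close>

lemma ex_turan2_near_cut:
  assumes G: "simple_graph V E" and X: "X \<subseteq> V" "2 * card X \<le> card V"
  obtains K where "is_turan2_on V K"
    "2 * real (card ((E - K) \<union> (K - E)))
      \<le> (\<Sum>u\<in>V. \<Sum>w\<in>V. \<bar>of_bool ({u, w} \<in> E) - of_bool ((u \<in> X) \<noteq> (w \<in> X))\<bar>)
        + real (card V) * (real (card V) - 2 * real (card X))"
proof -
  let ?n = "real (card V)"
  have fin: "finite V" and E: "E \<subseteq> {e. e \<subseteq> V \<and> card e = 2}"
    using G by (auto simp: simple_graph_def)
  obtain A where A: "X \<subseteq> A" "A \<subseteq> V" "card A = card V div 2"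
  proof -
    have "card X \<le> card V div 2" using X by linarith
    then have "\<exists>A. X \<subseteq> A \<and> A \<subseteq> V \<and> card A = card V div 2"
      by (rule exists_subset_between) (use X fin in auto)
    then show thesis using that by blast
  qed
  define K where "K = {{x, y} | x y. x \<in> A \<and> y \<in> V - A}"
  have cB: "card (V - A) = card V - card V div 2"
    using A fin by (metis card_Diff_subset finite_subset)
  have turan: "is_turan2_on V K"
    unfolding is_turan2_on_def
  proof (intro exI conjI)
    show "A \<union> (V - A) = V" "A \<inter> (V - A) = {}" using A by auto
    show "int (card A) = \<lfloor>?n / 2\<rfloor>"
      unfolding A(3) by linarith
    show "int (card (V - A)) = \<lceil>?n / 2\<rceil>"
      unfolding cB by linarith
    show "K = {{a, b} | a b. a \<in> A \<and> b \<in> V - A}" by (simp add: K_def)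
  qed
  have Kiff: "{u, w} \<in> K \<longleftrightarrow> (u \<in> A) \<noteq> (w \<in> A)" if "u \<in> V" "w \<in> V" for u w
    using that by (auto simp: K_def doubleton_eq_iff)
  have K: "K \<subseteq> {e. e \<subseteq> V \<and> card e = 2}"
    using A by (auto simp: K_def card_2_iff)
  have "finite A" using A fin finite_subset by blast
  have AX: "(\<Sum>u\<in>V. of_bool (u \<in> A - X)) = real (card A) - real (card X)"
  proof -
    have "(\<Sum>u\<in>V. of_bool (u \<in> A - X)) = real (card (V \<inter> (A - X)))"
      using fin by (simp add: sum.If_cases of_bool_def Int_def)
    also have "V \<inter> (A - X) = A - X" using A by auto
    also have "card (A - X) = card A - card X"
      using A(1) \<open>finite A\<close> by (intro card_Diff_subset) (auto intro: finite_subset)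
    also have "real (card A - card X) = real (card A) - real (card X)"
      by (rule of_nat_diff[OF card_mono[OF \<open>finite A\<close> A(1)]])
    finally show ?thesis .
  qed
  have "2 * real (card ((E - K) \<union> (K - E)))
      = (\<Sum>u\<in>V. \<Sum>w\<in>V. of_bool ({u, w} \<in> (E - K) \<union> (K - E)))"
    using E K by (intro sum_of_bool_pairs[symmetric] fin) auto
  \<comment> \<open>A pair separated by exactly one of the cuts \<open>X\<close> and
    \<open>A\<close> has an end in \<open>A - X\<close>.\<close>
  also have "\<dots> \<le> (\<Sum>u\<in>V. \<Sum>w\<in>V. \<bar>of_bool ({u, w} \<in> E) - of_bool ((u \<in> X) \<noteq> (w \<in> X))\<bar>
      + (of_bool (u \<in> A - X) + of_bool (w \<in> A - X)))"
  proof (intro sum_mono)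
    fix u w assume "u \<in> V" "w \<in> V"
    then show "(of_bool ({u, w} \<in> (E - K) \<union> (K - E)) :: real)
      \<le> \<bar>of_bool ({u, w} \<in> E) - of_bool ((u \<in> X) \<noteq> (w \<in> X))\<bar>
        + (of_bool (u \<in> A - X) + of_bool (w \<in> A - X))"
      using A(1) Kiff[of u w] by auto
  qed
  also have "\<dots> = (\<Sum>u\<in>V. \<Sum>w\<in>V. \<bar>of_bool ({u, w} \<in> E) - of_bool ((u \<in> X) \<noteq> (w \<in> X))\<bar>)
      + 2 * ?n * (real (card A) - real (card X))"
    by (simp only: sum.distrib sum_constant AX flip: sum_distrib_left)
  also have "2 * ?n * (real (card A) - real (card X)) \<le> ?n * (?n - 2 * real (card X))"
  proof -
    have "real (2 * card A) \<le> ?n" unfolding A(3) of_nat_le_iff by simp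
    then have "2 * (real (card A) - real (card X)) \<le> ?n - 2 * real (card X)" by simp
    from mult_left_mono[OF this, of ?n] show ?thesis by (simp add: mult_ac)
  qed
  finally show thesis using that[OF turan] by simp
qed

text \<open>The entrywise absolute value of an eigenvector for an eigenvalue of maximal modulus is enough
  for the argument; neither positivity nor the equality of Perron's theorem is needed.\<close>

lemma ex_subharmonic:
  assumes "finite V" "V \<noteq> {}"
  obtains f :: "'a \<Rightarrow> real" where "\<And>v. v \<in> V \<Longrightarrow> 0 \<le> f v" "0 < sum f V"
    "\<And>v. v \<in> V \<Longrightarrow> graph_spectral_radius V E * f v \<le> (\<Sum>w\<in>V. of_bool ({v, w} \<in> E) * f w)"
proof -
  obtain vs where vs: "distinct vs" "set vs = V"
    using finite_distinct_list[OF assms(1)] by blast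
  have "adj_mat vs E \<in> carrier_mat (length vs) (length vs)" by (simp add: adj_mat_def)
  moreover have "0 < length vs" using vs assms by auto
  ultimately have "spectral_radius (adj_mat vs E) \<in> norm ` spectrum (adj_mat vs E)"
    by (rule spectral_radius_mem_max(1))
  then obtain c where c: "eigenvalue (adj_mat vs E) c" "graph_spectral_radius V E = norm c"
    unfolding graph_spectral_radius_eq[OF vs, symmetric] spectrum_def by blast
  obtain g where g: "\<exists>x\<in>V. g x \<noteq> 0"
    "\<And>x. x \<in> V \<Longrightarrow> (\<Sum>y\<in>V. if {x, y} \<in> E then g y else 0) = c * g x"
    using c(1) unfolding eigenvalue_adj_mat_iff[OF vs(1)] vs(2) by blast
  show thesis
  proof (rule that[of "\<lambda>v. norm (g v)"])
    show "0 < (\<Sum>v\<in>V. norm (g v))" using g(1) assms(1) by (auto intro: sum_pos2)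
    fix v assume "v \<in> V"
    then have "norm c * norm (g v) = norm (\<Sum>y\<in>V. if {v, y} \<in> E then g y else 0)"
      using g(2) by (simp add: norm_mult)
    also have "\<dots> \<le> (\<Sum>w\<in>V. of_bool ({v, w} \<in> E) * norm (g w))"
      by (rule sum_norm_le) simp
    finally show "graph_spectral_radius V E * norm (g v) \<le> \<dots>" by (simp add: c)
  qed simp
qed

lemma sum_common_nbrs_le_booksize:
  assumes G: "simple_graph V E" and uv: "{u, v} \<in> E"
  shows "(\<Sum>x\<in>V. of_bool ({u, x} \<in> E) * of_bool ({v, x} \<in> E)) \<le> real (booksize E)"
proof -
  let ?C = "{card (nbhd E u \<inter> nbhd E v) | u v. {u, v} \<in> E}"
  have fin: "finite V" and E: "E \<subseteq> Pow V" using G by (auto simp: simple_graph_def)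
  have nV: "nbhd E x \<subseteq> V" for x using E by (auto simp: nbhd_def)
  have "?C \<subseteq> {..card V}"
  proof
    fix m assume "m \<in> ?C"
    then obtain x y where m: "m = card (nbhd E x \<inter> nbhd E y)" by blast
    have "card (nbhd E x \<inter> nbhd E y) \<le> card V" by (rule card_mono[OF fin]) (use nV in blast)
    then show "m \<in> {..card V}" by (simp add: m)
  qed
  then have "finite ?C" by (rule finite_subset) simp
  then have le: "card (nbhd E u \<inter> nbhd E v) \<le> booksize E"
    unfolding booksize_def using uv by (intro Max_ge) auto
  have "(\<Sum>x\<in>V. of_bool ({u, x} \<in> E) * of_bool ({v, x} \<in> E))
      = (\<Sum>x\<in>V. of_bool (x \<in> nbhd E u \<inter> nbhd E v) :: real)"
    by (simp add: nbhd_def of_bool_conj)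
  also have "\<dots> = real (card (V \<inter> (nbhd E u \<inter> nbhd E v)))"
    using fin by (simp add: sum.If_cases of_bool_def Int_def)
  also have "V \<inter> (nbhd E u \<inter> nbhd E v) = nbhd E u \<inter> nbhd E v"
    using nV by blast
  finally show ?thesis using le by simp
qed

section \<open>Choice of constants and conclusion\<close>

text \<open>With \<open>z = \<epsilon>\<^sup>2 / 30\<close> the cut is at distance at most 19 z n^2
  <= \<epsilon> n^2 from the graph, and balancing it costs at most another \<epsilon> n^2. Both
  count ordered pairs, so halving the sum gives \<epsilon> n^2 edges.\<close>

lemma spectral_book_stability:
  fixes V :: "'a set"
  assumes \<epsilon>: "0 < \<epsilon>" and G: "simple_graph V E"
    and \<rho>: "graph_spectral_radius V E \<ge> (1 / 2 - (\<epsilon>\<^sup>2 / 30)\<^sup>2) * real (card V)"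
    and bk: "real (booksize E) < (1 / 6 - \<epsilon>) * real (card V)"
  shows "\<exists>K. is_turan2_on V K \<and> real (card ((E - K) \<union> (K - E))) \<le> \<epsilon> * (real (card V))\<^sup>2"
proof -
  let ?n = "real (card V)" and ?b = "real (booksize E)"
  define z where "z = \<epsilon>\<^sup>2 / 30"
  interpret book_graph V "\<lambda>u v. of_bool ({u, v} \<in> E)" ?b
  proof
    show "finite V" using G by (simp add: simple_graph_def)
    show "(\<Sum>x\<in>V. of_bool ({u, x} \<in> E) * of_bool ({v, x} \<in> E)) \<le> ?b"
      if "of_bool ({u, v} \<in> E) = (1 :: real)" for u v
      using sum_common_nbrs_le_booksize[OF G, of u v] that by simp
  qed (auto simp: insert_commute)
  \<comment> \<open>As the booksize is nonnegative, its strict upper bound forces both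
    \<open>\<epsilon> < 1 / 6\<close> and a nonempty vertex set, so the spectral radius is a genuine
    one.\<close>
  have "0 < (1 / 6 - \<epsilon>) * ?n" using bk by (rule le_less_trans[rotated]) simp
  then have n: "0 < ?n" and \<epsilon>6: "\<epsilon> < 1 / 6" by (auto simp: zero_less_mult_iff)
  have V: "V \<noteq> {}" using n by auto
  have "\<epsilon>\<^sup>2 \<le> \<epsilon> / 6" using \<epsilon> \<epsilon>6 by (simp add: power2_eq_square)
  then have z: "0 < z" "z \<le> 1 / 4" "z \<le> \<epsilon>" "z \<le> \<epsilon> / 180"
    using \<epsilon> \<epsilon>6 by (auto simp: z_def)
  obtain f where f: "\<And>v. v \<in> V \<Longrightarrow> 0 \<le> f v" "0 < sum f V"
    "\<And>v. v \<in> V \<Longrightarrow> graph_spectral_radius V E * f v \<le> nb f v"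
    using ex_subharmonic[OF fin V, of E] unfolding nb_def by blast
  note bounds = vol_tris_bounds[OF f(1,3,2) _ less_imp_le[OF bk] z(1-3) \<rho>[folded z_def], simplified]
  obtain X where X: "X \<subseteq> V" "2 * card X \<le> card V"
    and D: "(\<Sum>u\<in>V. \<Sum>w\<in>V. \<bar>of_bool ({u, w} \<in> E) - of_bool ((u \<in> X) \<noteq> (w \<in> X))\<bar>) \<le> 19 * z * ?n\<^sup>2"
    and s: "(?n - 2 * real (card X))\<^sup>2 \<le> 22 * z * ?n\<^sup>2"
    using ex_small_near_cut[OF V less_imp_le[OF z(1)] bounds(1,2)] by blast
  note s
  \<comment> \<open>The square root taken here is why \<open>z\<close> is of order
    \<open>\<epsilon>\<^sup>2\<close>; any denominator from 22 on suffices for this step.\<close>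
  also have "22 * z * ?n\<^sup>2 \<le> (\<epsilon> * ?n)\<^sup>2" by (simp add: z_def power_mult_distrib)
  finally have "?n - 2 * real (card X) \<le> \<epsilon> * ?n"
    by (rule power2_le_imp_le) (use \<epsilon> in simp)
  then have "?n * (?n - 2 * real (card X)) \<le> ?n * (\<epsilon> * ?n)" by (rule mult_left_mono) simp
  then have s': "?n * (?n - 2 * real (card X)) \<le> \<epsilon> * ?n\<^sup>2" by (simp add: power2_eq_square mult_ac)
  have z19: "19 * z * ?n\<^sup>2 \<le> \<epsilon> * ?n\<^sup>2" using z \<epsilon> by (intro mult_right_mono) auto
  obtain K where K: "is_turan2_on V K"
    "2 * real (card ((E - K) \<union> (K - E)))
      \<le> (\<Sum>u\<in>V. \<Sum>w\<in>V. \<bar>of_bool ({u, w} \<in> E) - of_bool ((u \<in> X) \<noteq> (w \<in> X))\<bar>)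
        + ?n * (?n - 2 * real (card X))"
    by (rule ex_turan2_near_cut[OF G X])
  have "real (card ((E - K) \<union> (K - E))) \<le> \<epsilon> * ?n\<^sup>2"
    using K(2) D s' z19 by linarith
  with K(1) show ?thesis by blast
qed

theorem theorem1p8:
  shows "\<forall>\<epsilon>::real. \<epsilon> > 0 \<longrightarrow> (\<exists>\<delta>::real. \<delta> > 0 \<and>
    (\<forall>(n::nat) (V::'a set) (E::'a set set).
       simple_graph V E \<and> card V = n \<and>
       graph_spectral_radius V E \<ge> (1 / 2 - \<delta>) * real n \<longrightarrow>
         real (booksize E) \<ge> (1 / 6 - \<epsilon>) * real n \<or>
         (\<exists>K. is_turan2_on V K \<and>
              real (card ((E - K) \<union> (K - E))) \<le> \<epsilon> * (real n)\<^sup>2)))"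
proof (intro allI impI)
  fix \<epsilon> :: real assume "\<epsilon> > 0"
  then show "\<exists>\<delta>::real. \<delta> > 0 \<and>
    (\<forall>(n::nat) (V::'a set) (E::'a set set).
       simple_graph V E \<and> card V = n \<and>
       graph_spectral_radius V E \<ge> (1 / 2 - \<delta>) * real n \<longrightarrow>
         real (booksize E) \<ge> (1 / 6 - \<epsilon>) * real n \<or>
         (\<exists>K. is_turan2_on V K \<and>
              real (card ((E - K) \<union> (K - E))) \<le> \<epsilon> * (real n)\<^sup>2))"
    using spectral_book_stability[of \<epsilon>]
    by (intro exI[of _ "(\<epsilon>\<^sup>2 / 30)\<^sup>2"] conjI allI impI) (auto simp: not_le[symmetric])
qed

end
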